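(* Let $\phi$ be any deterministic mechanism for the unweighted House Allocation problem with strict preferences that is truthful, non-bossy and Pareto optimal, and let $Rand(\phi)$ be its symmetrization. Then the approximation ratio of the randomised mechanism $Rand(\phi)$ is not better than $\frac{e}{e-1}$; that is, there is no constant $c<\frac{e}{e-1}$ such that for every instance $I$ the maximum size of a matching in $I$ is at most $c$ times the expected size of the matching returned by $Rand(\phi)$ on $I$.
   Context: House Allocation with strict preferences (unweighted). An instance has a set $N=\{1,\dots,n_1\}$ of agents and a finite set $O$ of objects (of any finite sizes); each agent $i$ has a preference list $L(i)$, a strict linear order on a subset of $O$ (his acceptable objects; the list may be incomplete). A matching is a set of (agent, acceptable object) pairs in which every agent and every object occurs at most once; its size is the number of pairs. Every acceptable object is preferred to being unmatched; receiving an object unacceptable with respect to the true list counts the same as being unmatched. A matching $\mu$ is Pareto optimal if there is no matching $\mu'$ with $\mu'(i)\succeq_i\mu(i)$ for all agents $i$ and $\mu'(i')\succ_{i'}\mu(i')$ for some $i'$. A deterministic mechanism $\phi$ maps each instance (in particular, for given $N,O$, each profile $L=(L(1),\dots,L(n_1))$) to a matching; $\phi_i(L)$ is the outcome (object or unmatched) of agent $i$. It is Pareto optimal if it always returns a Pareto optimal matching; truthful if for all $L$, $i$, $L'(i)$, agent $i$ weakly prefers, according to $L(i)$, $\phi_i(L(i),L(-i))$ to $\phi_i(L'(i),L(-i))$; non-bossy if for all $i$, $L$, $L'(i)$, $\phi_i(L(i),L(-i))=\phi_i(L'(i),L(-i))$ implies $\phi(L(i),L(-i))=\phi(L'(i),L(-i))$.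 For a permutation $\sigma$ of $N$, the permuted mechanism $\sigma\odot\phi$ is defined by $(\sigma\odot\phi)_i(L)=\phi_{\sigma^{-1}(i)}(L(\sigma(1)),\dots,L(\sigma(n_1)))$ for each $i\in N$. The symmetrization $Rand(\phi)$ is the randomised mechanism which on $L$ returns the matching $\mu$ with probability $|\{\sigma:(\sigma\odot\phi)(L)=\mu\}|/n_1!$, $\sigma$ ranging over all permutations of $N$. *)

theory Defs
  imports
    "HOL-Probability.Probability"
    "HOL-Combinatorics.Permutations"
    "HOL-Library.Infinite_Typeclass"
begin

text \<open>
  An instance of House Allocation consists of the number \<open>n\<close> of agents (the agents are
  \<open>1, \<dots>, n\<close>), a finite set \<open>Ob\<close> of objects drawn from a universe \<open>'o\<close>, and a profile \<open>L\<close>.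
  The preference list \<open>L i\<close> is a repetition-free list of the acceptable objects of agent \<open>i\<close>,
  most preferred first. Profiles are normalised to \<open>[]\<close> outside the set of agents, so that
  every instance has exactly one representation.
\<close>

type_synonym 'o profile = "nat \<Rightarrow> 'o list"
type_synonym 'o matching = "(nat \<times> 'o) set"
type_synonym 'o mechanism = "nat \<Rightarrow> 'o set \<Rightarrow> 'o profile \<Rightarrow> 'o matching"
type_synonym 'o rand_mechanism = "nat \<Rightarrow> 'o set \<Rightarrow> 'o profile \<Rightarrow> 'o matching pmf"

definition agents :: "nat \<Rightarrow> nat set" where
  "agents n = {1..n}"

definition pref_list :: "'o set \<Rightarrow> 'o list \<Rightarrow> bool" where
  "pref_list Ob l \<longleftrightarrow> distinct l \<and> set l \<subseteq> Ob"

definition ha_instance :: "nat \<Rightarrow> 'o set \<Rightarrow> 'o profile \<Rightarrow> bool" where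
  "ha_instance n Ob L \<longleftrightarrow> finite Ob \<and>
     (\<forall>i\<in>agents n. pref_list Ob (L i)) \<and> (\<forall>i. i \<notin> agents n \<longrightarrow> L i = [])"

definition is_matching :: "nat \<Rightarrow> 'o profile \<Rightarrow> 'o matching \<Rightarrow> bool" where
  "is_matching n L M \<longleftrightarrow>
     (\<forall>(i, a)\<in>M. i \<in> agents n \<and> a \<in> set (L i)) \<and>
     (\<forall>i a b. (i, a) \<in> M \<and> (i, b) \<in> M \<longrightarrow> a = b) \<and>
     (\<forall>i j a. (i, a) \<in> M \<and> (j, a) \<in> M \<longrightarrow> i = j)"

definition outcome :: "'o matching \<Rightarrow> nat \<Rightarrow> 'o option" where
  "outcome M i = (if \<exists>a. (i, a) \<in> M then Some (THE a. (i, a) \<in> M) else None)"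

text \<open>
  The rank of an outcome is its position in the list. Being unmatched and receiving an
  unacceptable object both have rank \<open>length l\<close>, that is, they are equally good and worse
  than every acceptable object.
\<close>

definition rank :: "'o list \<Rightarrow> 'o option \<Rightarrow> nat" where
  "rank l x = (case x of None \<Rightarrow> length l | Some a \<Rightarrow> length (takeWhile (\<lambda>b. b \<noteq> a) l))"

definition weakly_prefers :: "'o list \<Rightarrow> 'o option \<Rightarrow> 'o option \<Rightarrow> bool" where
  "weakly_prefers l x y \<longleftrightarrow> rank l x \<le> rank l y"

definition strictly_prefers :: "'o list \<Rightarrow> 'o option \<Rightarrow> 'o option \<Rightarrow> bool" where
  "strictly_prefers l x y \<longleftrightarrow> rank l x < rank l y"

definition pareto_optimal_matching :: "nat \<Rightarrow> 'o profile \<Rightarrow> 'o matching \<Rightarrow> bool" where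
  "pareto_optimal_matching n L M \<longleftrightarrow> is_matching n L M \<and>
     \<not> (\<exists>M'. is_matching n L M' \<and>
            (\<forall>i\<in>agents n. weakly_prefers (L i) (outcome M' i) (outcome M i)) \<and>
            (\<exists>i\<in>agents n. strictly_prefers (L i) (outcome M' i) (outcome M i)))"

text \<open>
  The types of mechanisms are those of total functions; only their values on instances
  matter.
\<close>

definition is_mechanism :: "'o mechanism \<Rightarrow> bool" where
  "is_mechanism \<phi> \<longleftrightarrow> (\<forall>n Ob L. ha_instance n Ob L \<longrightarrow> is_matching n L (\<phi> n Ob L))"

definition pareto_optimal :: "'o mechanism \<Rightarrow> bool" where
  "pareto_optimal \<phi> \<longleftrightarrow>
     (\<forall>n Ob L. ha_instance n Ob L \<longrightarrow> pareto_optimal_matching n L (\<phi> n Ob L))"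

definition truthful :: "'o mechanism \<Rightarrow> bool" where
  "truthful \<phi> \<longleftrightarrow>
     (\<forall>n Ob L i l'. ha_instance n Ob L \<and> i \<in> agents n \<and> pref_list Ob l' \<longrightarrow>
        weakly_prefers (L i) (outcome (\<phi> n Ob L) i) (outcome (\<phi> n Ob (L(i := l'))) i))"

definition non_bossy :: "'o mechanism \<Rightarrow> bool" where
  "non_bossy \<phi> \<longleftrightarrow>
     (\<forall>n Ob L i l'. ha_instance n Ob L \<and> i \<in> agents n \<and> pref_list Ob l' \<and>
        outcome (\<phi> n Ob L) i = outcome (\<phi> n Ob (L(i := l'))) i \<longrightarrow>
        \<phi> n Ob L = \<phi> n Ob (L(i := l')))"

text \<open>
  Agent \<open>i\<close> takes the role \<open>inv \<sigma> i\<close> in \<open>\<phi>\<close>, while role \<open>j\<close> reports the list \<open>L (\<sigma> j)\<close>.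
\<close>

definition permuted :: "(nat \<Rightarrow> nat) \<Rightarrow> 'o mechanism \<Rightarrow> 'o mechanism" where
  "permuted \<sigma> \<phi> n Ob L = {(i, a). (inv \<sigma> i, a) \<in> \<phi> n Ob (L \<circ> \<sigma>)}"

lemma outcome_permuted:
  "outcome (permuted \<sigma> \<phi> n Ob L) i = outcome (\<phi> n Ob (L \<circ> \<sigma>)) (inv \<sigma> i)"
  by (simp add: outcome_def permuted_def)

definition Rand :: "'o mechanism \<Rightarrow> 'o rand_mechanism" where
  "Rand \<phi> n Ob L =
     map_pmf (\<lambda>\<sigma>. permuted \<sigma> \<phi> n Ob L) (pmf_of_set {\<sigma>. \<sigma> permutes agents n})"

lemma pmf_Rand:
  "pmf (Rand \<phi> n Ob L) M =
     real (card {\<sigma>. \<sigma> permutes agents n \<and> permuted \<sigma> \<phi> n Ob L = M}) / fact n"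
proof -
  have fin: "finite {\<sigma>. \<sigma> permutes agents n}"
    by (simp add: agents_def finite_permutations)
  have ne: "{\<sigma>. \<sigma> permutes agents n} \<noteq> {}"
    using permutes_id by blast
  have card: "card {\<sigma>. \<sigma> permutes agents n} = fact n"
    by (rule card_permutations) (simp_all add: agents_def)
  have eq: "{\<sigma>. \<sigma> permutes agents n} \<inter> (\<lambda>\<sigma>. permuted \<sigma> \<phi> n Ob L) -` {M}
      = {\<sigma>. \<sigma> permutes agents n \<and> permuted \<sigma> \<phi> n Ob L = M}"
    by auto
  show ?thesis
    unfolding Rand_def pmf_map
    by (subst measure_pmf_of_set[OF ne fin]) (simp add: card eq)
qed

definition max_matching_size :: "nat \<Rightarrow> 'o profile \<Rightarrow> nat" where
  "max_matching_size n L = Max (card ` {M. is_matching n L M})"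

definition expected_size :: "'o matching pmf \<Rightarrow> real" where
  "expected_size p = measure_pmf.expectation p (\<lambda>M. real (card M))"

definition approximates :: "real \<Rightarrow> 'o rand_mechanism \<Rightarrow> bool" where
  "approximates c R \<longleftrightarrow>
     (\<forall>n Ob L. ha_instance n Ob L \<longrightarrow>
        real (max_matching_size n L) \<le> c * expected_size (R n Ob L))"

text \<open>
  \<open>Max\<close> in \<^const>\<open>max_matching_size\<close> is taken over a nonempty finite set.
\<close>

lemma finite_matchings: "finite {M. is_matching n L M}"
proof (rule finite_subset)
  show "{M. is_matching n L M} \<subseteq> Pow (SIGMA i:agents n. set (L i))"
    by (auto simp: is_matching_def)
  show "finite (Pow (SIGMA i:agents n. set (L i)))"
    by (simp add: agents_def)
qed

lemma is_matching_empty: "is_matching n L {}"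
  by (simp add: is_matching_def)

end

theory Submission
  imports Defs "HOL-Real_Asymp.Real_Asymp"
begin

text \<open>
  On the triangular instance, in which agent \<open>i\<close> has the list \<open>o\<^sub>1, \<dots>, o\<^sub>i\<close>, the agents
  \<open>j, \<dots>, n\<close> who accept \<open>o\<^sub>j\<close> all get it with the same probability under the symmetrization, hence
  with probability at most \<open>1 / (n + 1 - j)\<close>. So agent \<open>i\<close> is matched with probability at most
  \<open>min 1 (H\<^sub>n - H\<^bsub>n-i\<^esub>)\<close>, and using the harmonic bound for the first \<open>n - k\<close> agents only, where
  \<open>k \<approx> n / e\<close>, the expected size is at most
  \<open>n - k (H\<^sub>n - H\<^sub>k) \<approx> (1 - 1 / e) n\<close>, whereas there is a matching of size \<open>n\<close>.
\<close>

section \<open>Outcomes, ranks and Pareto improvements\<close>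

lemma outcome_eq_Some_iff:
  assumes "is_matching n L M"
  shows "outcome M i = Some a \<longleftrightarrow> (i, a) \<in> M"
proof -
  have uniq: "a = b" if "(i, a) \<in> M" "(i, b) \<in> M" for a b
    using assms that unfolding is_matching_def by blast
  show ?thesis
  proof (cases "\<exists>b. (i, b) \<in> M")
    case True
    then obtain b where b: "(i, b) \<in> M" by blast
    have "(THE a. (i, a) \<in> M) = b"
      using b uniq by blast
    then show ?thesis
      using b uniq by (auto simp: outcome_def)
  qed (auto simp: outcome_def)
qed

lemma rank_append_Some: "a \<in> set p \<Longrightarrow> rank (p @ ys) (Some a) = rank p (Some a)"
  by (simp add: rank_def)

lemma rank_less_length: "a \<in> set l \<Longrightarrow> rank l (Some a) < length l"
  by (induction l) (auto simp: rank_def)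

text \<open>Being unmatched or holding an object outside \<open>p\<close> has rank at least
  \<open>length p\<close>, so the rank bounds that truthfulness supplies locate an outcome inside a
  prefix.\<close>

lemma rank_append_less_lengthD:
  assumes "rank (p @ ys) y < length p"
  shows "\<exists>b\<in>set p. y = Some b"
proof (cases y)
  case (Some b)
  have "b \<in> set p"
  proof (rule ccontr)
    assume "b \<notin> set p"
    then have "takeWhile (\<lambda>c. c \<noteq> b) (p @ ys) = p @ takeWhile (\<lambda>c. c \<noteq> b) ys"
      by (intro takeWhile_append2) auto
    then show False using assms Some by (simp add: rank_def)
  qed
  with Some show ?thesis by blast
qed (use assms in \<open>simp add: rank_def\<close>)

lemma rank_Some_inj:
  assumes "a \<in> set l" "b \<in> set l" "rank l (Some a) = rank l (Some b)"
  shows "a = b"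
proof -
  have nth: "l ! rank l (Some c) = c" if "c \<in> set l" for c
    using nth_length_takeWhile[of "\<lambda>b. b \<noteq> c" l] rank_less_length[OF that]
    by (simp add: rank_def)
  show ?thesis using assms nth by metis
qed

lemma rank_append_Cons: "x \<notin> set xs \<Longrightarrow> rank (xs @ x # ys) (Some x) = length xs"
proof -
  assume "x \<notin> set xs"
  then have "takeWhile (\<lambda>c. c \<noteq> x) (xs @ x # ys) = xs @ takeWhile (\<lambda>c. c \<noteq> x) (x # ys)"
    by (intro takeWhile_append2) auto
  then show ?thesis by (simp add: rank_def)
qed

lemma ha_instance_fun_upd:
  "ha_instance n Ob L \<Longrightarrow> i \<in> agents n \<Longrightarrow> pref_list Ob l \<Longrightarrow> ha_instance n Ob (L(i := l))"
  by (auto simp: ha_instance_def)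

lemma ha_instance_comp:
  "ha_instance n Ob L \<Longrightarrow> \<sigma> permutes agents n \<Longrightarrow> ha_instance n Ob (L \<circ> \<sigma>)"
  by (auto simp: ha_instance_def permutes_in_image)

lemma fun_upd_comp_bij:
  assumes "bij \<sigma>"
  shows "L(i := l) \<circ> \<sigma> = (L \<circ> \<sigma>)(inv \<sigma> i := l)"
  using assms by (auto simp: fun_eq_iff bij_inv_eq_iff)

text \<open>Otherwise handing \<open>x\<close> to agent \<open>i\<close> is a Pareto improvement.\<close>

lemma pareto_optimal_unassigned:
  assumes inst: "ha_instance n Ob L" and i: "i \<in> agents n"
    and po: "pareto_optimal_matching n L M"
    and Li: "L i = xs @ x # ys" and un: "\<forall>k. (k, x) \<notin> M"
  shows "\<exists>a\<in>set xs. outcome M i = Some a"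
proof (rule ccontr)
  assume no: "\<not> ?thesis"
  define M' where "M' = {(k, a). (k, a) \<in> M \<and> k \<noteq> i} \<union> {(i, x)}"
  have mM: "is_matching n L M"
    using po by (simp add: pareto_optimal_matching_def)
  have mM': "is_matching n L M'"
    using mM un i Li unfolding is_matching_def M'_def by auto blast
  have "x \<notin> set xs"
    using inst i Li by (auto simp: ha_instance_def pref_list_def dest!: bspec)
  then have rx: "rank (L i) (Some x) = length xs"
    by (simp add: Li rank_append_Cons)
  have ox: "outcome M' i = Some x"
    unfolding outcome_eq_Some_iff[OF mM'] by (simp add: M'_def)
  have other: "outcome M' k = outcome M k" if "k \<noteq> i" for k
    using that by (simp add: outcome_def M'_def)
  \<comment> \<open>A rank of at most \<open>length xs\<close> would place the outcome in
    \<open>xs @ [x]\<close>, but \<open>xs\<close> is excluded by \<open>no\<close> and nobody holds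
    \<open>x\<close>.\<close>
  have "rank (L i) (outcome M i) > length xs"
  proof (rule ccontr)
    assume "\<not> ?thesis"
    then have "rank ((xs @ [x]) @ ys) (outcome M i) < length (xs @ [x])"
      by (simp add: Li)
    then obtain b where "b \<in> set (xs @ [x])" "outcome M i = Some b"
      by (blast dest: rank_append_less_lengthD)
    then show False
      using no un outcome_eq_Some_iff[OF mM] by auto
  qed
  then have "\<forall>k\<in>agents n. weakly_prefers (L k) (outcome M' k) (outcome M k)"
    "strictly_prefers (L i) (outcome M' i) (outcome M i)"
    using rx ox other by (auto simp: weakly_prefers_def strictly_prefers_def) (metis less_imp_le order_refl)
  then show False
    using po mM' i unfolding pareto_optimal_matching_def by blast
qed

section \<open>Changing a list behind a prefix\<close>

context
  fixes \<phi> :: "'o mechanism"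
  assumes truthful: "truthful \<phi>" and non_bossy: "non_bossy \<phi>" and po: "pareto_optimal \<phi>"
begin

lemma is_matching_mechanism: "ha_instance n Ob L \<Longrightarrow> is_matching n L (\<phi> n Ob L)"
  using po by (simp add: pareto_optimal_def pareto_optimal_matching_def)

text \<open>Truthfulness is applied twice, with each of the two lists in turn as the true one. Ranks
  inside \<open>p\<close> do not depend on the tail, so the two outcomes have equal rank and
  coincide.\<close>

lemma outcome_in_common_prefix:
  assumes inst: "ha_instance n Ob L" and i: "i \<in> agents n"
    and Li: "L i = p @ ys" and l': "pref_list Ob (p @ zs)"
    and a: "a \<in> set p" and out: "outcome (\<phi> n Ob L) i = Some a"
  shows "outcome (\<phi> n Ob (L(i := p @ zs))) i = Some a"
proof -
  define y where "y = outcome (\<phi> n Ob (L(i := p @ zs))) i"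
  have inst': "ha_instance n Ob (L(i := p @ zs))"
    using inst i l' by (rule ha_instance_fun_upd)
  have l: "pref_list Ob (p @ ys)"
    using inst i Li by (auto simp: ha_instance_def dest: bspec)
  have "L(i := p @ zs, i := p @ ys) = L"
    using Li by (simp add: fun_eq_iff)
  \<comment> \<open>The true list is \<open>p @ zs\<close> here; the misreport \<open>p @ ys\<close>
    would yield \<open>a\<close>.\<close>
  then have "weakly_prefers (p @ zs) y (Some a)"
    using truthful[unfolded truthful_def, rule_format, of n Ob "L(i := p @ zs)" i "p @ ys"]
      inst' i l out by (simp add: y_def)
  then have le: "rank (p @ zs) y \<le> rank p (Some a)"
    using a by (simp add: weakly_prefers_def rank_append_Some)
  also have "\<dots> < length p"
    using a by (rule rank_less_length)
  finally obtain b where b: "b \<in> set p" "y = Some b"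
    by (blast dest: rank_append_less_lengthD)
  have "weakly_prefers (p @ ys) (Some a) y"
    using truthful[unfolded truthful_def, rule_format, of n Ob L i "p @ zs"]
      inst i l' out Li by (simp add: y_def)
  then have "rank p (Some a) = rank p (Some b)"
    using le a b by (simp add: weakly_prefers_def rank_append_Some)
  then have "a = b" by (rule rank_Some_inj[OF a b(1)])
  then show ?thesis using b y_def by simp
qed

text \<open>If \<open>x\<close> is left over, Pareto optimality gives agent \<open>i\<close>
  something he prefers to \<open>x\<close>. He keeps it under the new list by
  \<open>outcome_in_common_prefix\<close>, and non-bossiness then freezes the whole
  matching.\<close>

lemma unassigned_common_prefix:
  assumes inst: "ha_instance n Ob L" and i: "i \<in> agents n"
    and Li: "L i = (xs @ [x]) @ ys" and l': "pref_list Ob ((xs @ [x]) @ zs)"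
    and un: "\<forall>k. (k, x) \<notin> \<phi> n Ob L"
  shows "\<forall>k. (k, x) \<notin> \<phi> n Ob (L(i := (xs @ [x]) @ zs))"
proof -
  have "pareto_optimal_matching n L (\<phi> n Ob L)"
    using po inst by (simp add: pareto_optimal_def)
  then obtain a where a: "a \<in> set xs" "outcome (\<phi> n Ob L) i = Some a"
    using pareto_optimal_unassigned[OF inst i _ _ un, of xs ys] Li by auto
  have "outcome (\<phi> n Ob (L(i := (xs @ [x]) @ zs))) i = Some a"
    by (rule outcome_in_common_prefix[OF inst i Li l']) (use a in auto)
  then have "\<phi> n Ob L = \<phi> n Ob (L(i := (xs @ [x]) @ zs))"
    using non_bossy[unfolded non_bossy_def, rule_format, of n Ob L i] inst i l' a by simp
  then show ?thesis using un by simp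
qed

section \<open>Transfer to the permuted mechanisms\<close>

lemma is_matching_permuted:
  assumes inst: "ha_instance n Ob L" and \<sigma>: "\<sigma> permutes agents n"
  shows "is_matching n L (permuted \<sigma> \<phi> n Ob L)"
proof -
  note m = is_matching_mechanism[OF ha_instance_comp[OF inst \<sigma>]]
  have inv: "\<sigma> (inv \<sigma> i) = i" for i
    by (rule permutes_inverses(1)[OF \<sigma>])
  have in_iff: "inv \<sigma> i \<in> agents n \<longleftrightarrow> i \<in> agents n" for i
    by (rule permutes_in_image[OF permutes_inv[OF \<sigma>]])
  have "i \<in> agents n \<and> a \<in> set (L i)" if "(inv \<sigma> i, a) \<in> \<phi> n Ob (L \<circ> \<sigma>)" for i a
    using m that in_iff[of i] inv[of i] unfolding is_matching_def by force
  moreover have "a = b" if "(inv \<sigma> i, a) \<in> \<phi> n Ob (L \<circ> \<sigma>)" "(inv \<sigma> i, b) \<in> \<phi> n Ob (L \<circ> \<sigma>)" for i a b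
    using m that unfolding is_matching_def by blast
  moreover have "i = j" if "(inv \<sigma> i, a) \<in> \<phi> n Ob (L \<circ> \<sigma>)" "(inv \<sigma> j, a) \<in> \<phi> n Ob (L \<circ> \<sigma>)" for i j a
    using m that inv unfolding is_matching_def by metis
  ultimately show ?thesis
    unfolding is_matching_def permuted_def by blast
qed

text \<open>The list of agent \<open>i\<close> sits at position \<open>inv \<sigma> i\<close> of
  \<open>L \<circ> \<sigma>\<close>, so changing it is a unilateral change of one role in
  \<open>\<phi>\<close>.\<close>

lemma permuted_common_prefix:
  assumes inst: "ha_instance n Ob L" and i: "i \<in> agents n" and \<sigma>: "\<sigma> permutes agents n"
    and Li: "L i = p @ ys" and l': "pref_list Ob (p @ zs)"
    and a: "a \<in> set p" and "(i, a) \<in> permuted \<sigma> \<phi> n Ob L"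
  shows "(i, a) \<in> permuted \<sigma> \<phi> n Ob (L(i := p @ zs))"
proof -
  have i': "inv \<sigma> i \<in> agents n"
    using i permutes_in_image[OF permutes_inv[OF \<sigma>]] by blast
  note inst' = ha_instance_comp[OF inst \<sigma>]
    and inst'' = ha_instance_comp[OF ha_instance_fun_upd[OF inst i l'] \<sigma>]
  have "outcome (\<phi> n Ob ((L \<circ> \<sigma>)(inv \<sigma> i := p @ zs))) (inv \<sigma> i) = Some a"
  proof (rule outcome_in_common_prefix[OF inst' i' _ l' a])
    show "(L \<circ> \<sigma>) (inv \<sigma> i) = p @ ys"
      using Li permutes_inverses(1)[OF \<sigma>] by simp
    show "outcome (\<phi> n Ob (L \<circ> \<sigma>)) (inv \<sigma> i) = Some a"
      using assms(7) outcome_eq_Some_iff[OF is_matching_mechanism[OF inst']]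
      by (simp add: permuted_def)
  qed
  then show ?thesis
    using outcome_eq_Some_iff[OF is_matching_mechanism[OF inst'']]
    by (simp add: permuted_def fun_upd_comp_bij[OF permutes_bij[OF \<sigma>]])
qed

lemma permuted_unassigned_common_prefix:
  assumes inst: "ha_instance n Ob L" and i: "i \<in> agents n" and \<sigma>: "\<sigma> permutes agents n"
    and Li: "L i = (xs @ [x]) @ ys" and l': "pref_list Ob ((xs @ [x]) @ zs)"
    and un: "\<forall>k. (k, x) \<notin> permuted \<sigma> \<phi> n Ob L"
  shows "\<forall>k. (k, x) \<notin> permuted \<sigma> \<phi> n Ob (L(i := (xs @ [x]) @ zs))"
proof -
  have i': "inv \<sigma> i \<in> agents n"
    using i permutes_in_image[OF permutes_inv[OF \<sigma>]] by blast
  have "\<forall>k. (k, x) \<notin> \<phi> n Ob ((L \<circ> \<sigma>)(inv \<sigma> i := (xs @ [x]) @ zs))"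
  proof (rule unassigned_common_prefix[OF ha_instance_comp[OF inst \<sigma>] i' _ l'])
    show "(L \<circ> \<sigma>) (inv \<sigma> i) = (xs @ [x]) @ ys"
      using Li permutes_inverses(1)[OF \<sigma>] by simp
    show "\<forall>k. (k, x) \<notin> \<phi> n Ob (L \<circ> \<sigma>)"
    proof
      fix k
      show "(k, x) \<notin> \<phi> n Ob (L \<circ> \<sigma>)"
        using un[rule_format, of "\<sigma> k"] permutes_inverses(2)[OF \<sigma>]
        by (simp add: permuted_def)
    qed
  qed
  then show ?thesis
    by (simp add: permuted_def fun_upd_comp_bij[OF permutes_bij[OF \<sigma>]])
qed

section \<open>Counting permutations that assign an object\<close>

text \<open>On an instance, the cardinality divided by \<open>fact n\<close> is the probability that
  \<open>Rand \<phi>\<close> gives \<open>x\<close> to \<open>i\<close>. Counting keeps the symmetry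
  argument in the natural numbers.\<close>

definition receive :: "nat \<Rightarrow> 'o set \<Rightarrow> 'o profile \<Rightarrow> nat \<Rightarrow> 'o \<Rightarrow> (nat \<Rightarrow> nat) set" where
  "receive n Ob L i x = {\<sigma>. \<sigma> permutes agents n \<and> (i, x) \<in> permuted \<sigma> \<phi> n Ob L}"

lemma finite_receive: "finite (receive n Ob L i x)"
  by (rule finite_subset[OF _ finite_permutations[of "agents n"]])
    (auto simp: receive_def agents_def)

lemma receive_common_prefix:
  assumes "ha_instance n Ob L" "i \<in> agents n" "L i = p @ ys" "pref_list Ob (p @ zs)" "a \<in> set p"
  shows "receive n Ob (L(i := p @ zs)) i a = receive n Ob L i a"
proof -
  have "pref_list Ob (p @ ys)"
    using assms(1-3) by (auto simp: ha_instance_def dest: bspec)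
  moreover have "L(i := p @ zs, i := p @ ys) = L"
    using assms(3) by (simp add: fun_eq_iff)
  ultimately have "(i, a) \<in> permuted \<sigma> \<phi> n Ob (L(i := p @ zs)) \<longleftrightarrow> (i, a) \<in> permuted \<sigma> \<phi> n Ob L"
    if "\<sigma> permutes agents n" for \<sigma>
    using permuted_common_prefix[OF assms(1,2) that assms(3,4,5)]
      permuted_common_prefix[OF ha_instance_fun_upd[OF assms(1,2,4)] assms(2) that _ _ assms(5), of zs ys]
    by (metis fun_upd_same)
  then show ?thesis
    unfolding receive_def by blast
qed

text \<open>Since either list can be replaced by the other, unassignedness transfers both ways. The
  union over \<open>k\<close> is needed because the recipient of \<open>x\<close> may
  change.\<close>

lemma assigned_common_prefix:
  assumes "ha_instance n Ob L" "i \<in> agents n" "L i = (xs @ [x]) @ ys" "pref_list Ob ((xs @ [x]) @ zs)"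
  shows "(\<Union>k. receive n Ob (L(i := (xs @ [x]) @ zs)) k x) = (\<Union>k. receive n Ob L k x)"
proof -
  have l: "pref_list Ob ((xs @ [x]) @ ys)"
    using assms(1-3) by (auto simp: ha_instance_def dest: bspec)
  have L: "L(i := (xs @ [x]) @ zs, i := (xs @ [x]) @ ys) = L"
    using assms(3) by (simp add: fun_eq_iff)
  have "(\<forall>k. (k, x) \<notin> permuted \<sigma> \<phi> n Ob (L(i := (xs @ [x]) @ zs))) \<longleftrightarrow>
      (\<forall>k. (k, x) \<notin> permuted \<sigma> \<phi> n Ob L)" if "\<sigma> permutes agents n" for \<sigma>
    using permuted_unassigned_common_prefix[OF assms(1,2) that assms(3,4)]
      permuted_unassigned_common_prefix[OF ha_instance_fun_upd[OF assms(1,2,4)] assms(2) that _ l, of zs]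
    unfolding L by auto
  moreover have "(\<Union>k. receive n Ob M k x) =
      {\<sigma>. \<sigma> permutes agents n \<and> \<not> (\<forall>k. (k, x) \<notin> permuted \<sigma> \<phi> n Ob M)}" for M
    by (auto simp: receive_def)
  ultimately show ?thesis
    by (simp only:) (rule Collect_cong, rule conj_cong, simp_all)
qed

text \<open>Swapping \<open>i\<close> and \<open>k\<close> fixes \<open>L\<close>, so
  \<open>\<sigma>\<close> and \<open>?\<tau> \<circ> \<sigma>\<close> feed the same profile to
  \<open>\<phi>\<close> and differ only in which of the two agents plays which role. Composition
  with \<open>?\<tau>\<close> is an involution, hence a bijection.\<close>

lemma card_receive_same_list:
  assumes "i \<in> agents n" "k \<in> agents n" "L i = L k"
  shows "card (receive n Ob L i x) = card (receive n Ob L k x)"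
proof -
  let ?\<tau> = "Transposition.transpose i k"
  have \<tau>: "?\<tau> permutes agents n"
    using assms by (intro permutes_swap_id)
  have L: "L \<circ> ?\<tau> = L"
    using assms(3) by (auto simp: fun_eq_iff Transposition.transpose_def)
  have mem: "?\<tau> \<circ> \<sigma> \<in> receive n Ob L (?\<tau> j) x" if "\<sigma> \<in> receive n Ob L j x" for j \<sigma>
  proof -
    have \<sigma>: "\<sigma> permutes agents n" "(inv \<sigma> j, x) \<in> \<phi> n Ob (L \<circ> \<sigma>)"
      using that by (auto simp: receive_def permuted_def)
    have "inv (?\<tau> \<circ> \<sigma>) = inv \<sigma> \<circ> ?\<tau>"
      using o_inv_distrib[OF permutes_bij[OF \<tau>] permutes_bij[OF \<sigma>(1)]]
      by (simp only: inv_transpose_eq)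
    moreover have "L \<circ> (?\<tau> \<circ> \<sigma>) = L \<circ> \<sigma>"
      using L by (simp add: o_assoc)
    ultimately show ?thesis
      using \<sigma> permutes_compose[OF \<sigma>(1) \<tau>] by (simp add: receive_def permuted_def)
  qed
  have "bij_betw (\<lambda>\<sigma>. ?\<tau> \<circ> \<sigma>) (receive n Ob L i x) (receive n Ob L k x)"
    by (rule bij_betw_byWitness[where f' = "\<lambda>\<sigma>. ?\<tau> \<circ> \<sigma>"])
      (use mem[of _ i] mem[of _ k] in \<open>auto simp: o_assoc\<close>)
  then show ?thesis by (rule bij_betw_same_card)
qed

text \<open>For each \<open>\<sigma>\<close> at most one agent holds \<open>x\<close>, so the sets
  are disjoint, and \<open>T\<close> contains everyone who can hold it.\<close>

lemma sum_card_receive: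
  assumes inst: "ha_instance n Ob L" and T: "T \<subseteq> agents n"
    and out: "\<And>i. i \<notin> T \<Longrightarrow> x \<notin> set (L i)"
  shows "(\<Sum>i\<in>T. card (receive n Ob L i x)) = card (\<Union>k. receive n Ob L k x)"
proof -
  have "receive n Ob L k x = {}" if "k \<notin> T" for k
    using out[OF that] is_matching_permuted[OF inst]
    by (fastforce simp: receive_def is_matching_def)
  then have "(\<Union>k. receive n Ob L k x) = (\<Union>k\<in>T. receive n Ob L k x)"
    by blast
  moreover have "receive n Ob L i x \<inter> receive n Ob L k x = {}" if "i \<noteq> k" for i k
    using that is_matching_permuted[OF inst] unfolding receive_def is_matching_def by blast
  moreover have "finite T"
    using T by (rule finite_subset) (simp add: agents_def)
  ultimately show ?thesis
    by (simp add: card_UN_disjoint finite_receive)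
qed

text \<open>
  Induction on the number of agents in \<open>T\<close> whose list goes on after \<open>x\<close>. Cutting such a list
  after \<open>x\<close> changes neither the chance of its owner to get \<open>x\<close> (truthfulness) nor the event that \<open>x\<close>
  is assigned (non-bossiness and Pareto optimality); agents with identical lists have equal
  chances. For a single \<open>\<sigma>\<close>, cutting a list may well hand \<open>x\<close> over from one other
  agent to another, so the averaging over \<open>\<sigma>\<close> is essential.
\<close>

lemma equal_shares:
  assumes "ha_instance n Ob L" and T: "T \<subseteq> agents n" and p: "p = xs @ [x]" "pref_list Ob p"
    and "\<And>i. i \<in> T \<Longrightarrow> \<exists>ys. L i = p @ ys" and "\<And>i. i \<notin> T \<Longrightarrow> x \<notin> set (L i)" and "i \<in> T"
  shows "card T * card (receive n Ob L i x) = card (\<Union>k. receive n Ob L k x)"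
  using assms(1,5-)
proof (induction "card {i\<in>T. L i \<noteq> p}" arbitrary: L i rule: less_induct)
  case less
  note inst = less.prems(1) and pre = less.prems(2) and out = less.prems(3)
  let ?S = "\<lambda>L. card (\<Union>k. receive n Ob L k x)"
  let ?A = "{i\<in>T. L i = p}" and ?B = "{i\<in>T. L i \<noteq> p}"
  have fin: "finite T"
    using T by (rule finite_subset) (simp add: agents_def)
  have long: "card T * card (receive n Ob L k x) = ?S L" if k: "k \<in> ?B" for k
  proof -
    obtain ys where ys: "L k = p @ ys" using pre k by blast
    have kn: "k \<in> agents n" using k T by blast
    let ?L = "L(k := p)"
    have "{i\<in>T. ?L i \<noteq> p} \<subset> ?B" using k by auto
    then have "card {i\<in>T. ?L i \<noteq> p} < card ?B"
      using fin by (intro psubset_card_mono) auto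
    moreover have "\<exists>ys. ?L i = p @ ys" if "i \<in> T" for i
      using pre[OF that] by auto
    moreover have "x \<notin> set (?L i)" if "i \<notin> T" for i
      using out[OF that] k that by auto
    ultimately have "card T * card (receive n Ob ?L k x) = ?S ?L"
      using k ha_instance_fun_upd[OF inst kn p(2)] by (intro less.hyps) auto
    moreover have "receive n Ob ?L k x = receive n Ob L k x"
      using receive_common_prefix[OF inst kn ys, of "[]" x] p by simp
    moreover have "(\<Union>j. receive n Ob ?L j x) = (\<Union>j. receive n Ob L j x)"
      using assigned_common_prefix[OF inst kn, of xs x ys "[]"] ys p by simp
    ultimately show ?thesis by simp
  qed
  show ?case
  proof (cases "L i = p")
    case False
    then show ?thesis using long less.prems(4) by blast
  next
    case True
    have same: "card (receive n Ob L k x) = card (receive n Ob L i x)" if "k \<in> ?A" for k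
      using that True T less.prems(4) by (intro card_receive_same_list) auto
    have A: "card ?A > 0"
      using True less.prems(4) fin by (auto simp: card_gt_0_iff)
    have cT: "card T = card ?A + card ?B"
      using fin by (subst card_Un_disjoint[symmetric]) (auto intro: arg_cong[where f = card])
    have "?S L = (\<Sum>k\<in>T. card (receive n Ob L k x))"
      using sum_card_receive[OF inst T out] by simp
    also have "\<dots> = (\<Sum>k\<in>?A \<union> ?B. card (receive n Ob L k x))"
      by (rule sum.cong) auto
    also have "\<dots> = (\<Sum>k\<in>?A. card (receive n Ob L k x)) + (\<Sum>k\<in>?B. card (receive n Ob L k x))"
      using fin by (intro sum.union_disjoint) auto
    also have "(\<Sum>k\<in>?A. card (receive n Ob L k x)) = card ?A * card (receive n Ob L i x)"
      using same by simp
    \<comment> \<open>Multiplying by \<open>card T\<close> avoids division. Each agent in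
      \<open>?B\<close> then contributes exactly \<open>?S L\<close>; subtracting these terms leaves
      an equation in which \<open>card ?A > 0\<close> cancels.\<close>
    finally have "card T * ?S L =
        card ?A * (card T * card (receive n Ob L i x)) + (\<Sum>k\<in>?B. card T * card (receive n Ob L k x))"
      by (simp add: algebra_simps sum_distrib_left)
    also have "(\<Sum>k\<in>?B. card T * card (receive n Ob L k x)) = card ?B * ?S L"
      using long by simp
    finally have "card ?A * ?S L = card ?A * (card T * card (receive n Ob L i x))"
      unfolding cT by (simp add: algebra_simps)
    then show ?thesis using A by simp
  qed
qed

lemma card_receive_le:
  assumes "ha_instance n Ob L" "T \<subseteq> agents n" "p = xs @ [x]" "pref_list Ob p"
    and "\<And>i. i \<in> T \<Longrightarrow> \<exists>ys. L i = p @ ys" and "\<And>i. i \<notin> T \<Longrightarrow> x \<notin> set (L i)" and "i \<in> T"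
  shows "card T * card (receive n Ob L i x) \<le> fact n"
proof -
  have "card (\<Union>k. receive n Ob L k x) \<le> card {\<sigma>. \<sigma> permutes agents n}"
    by (rule card_mono) (auto simp: receive_def agents_def finite_permutations)
  also have "\<dots> = fact n"
    by (rule card_permutations) (simp_all add: agents_def)
  finally show ?thesis using equal_shares[OF assms] by simp
qed

section \<open>Expected size of the random matching\<close>

text \<open>Linearity of expectation: the size of a matching is the sum of the indicators of its
  acceptable pairs, and the sums over pairs and permutations are exchanged.\<close>

lemma expected_size_Rand:
  assumes inst: "ha_instance n Ob L"
  shows "expected_size (Rand \<phi> n Ob L) =
    (\<Sum>i\<in>agents n. \<Sum>x\<in>set (L i). card (receive n Ob L i x)) / fact n"
proof -
  let ?P = "{\<sigma>. \<sigma> permutes agents n}"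
  have fin: "finite ?P" by (simp add: agents_def finite_permutations)
  have ne: "?P \<noteq> {}" using permutes_id by blast
  have cP: "card ?P = fact n"
    by (rule card_permutations) (simp_all add: agents_def)
  have card: "card (permuted \<sigma> \<phi> n Ob L) =
      (\<Sum>i\<in>agents n. \<Sum>x\<in>set (L i). if (i, x) \<in> permuted \<sigma> \<phi> n Ob L then 1 else 0)"
    if "\<sigma> \<in> ?P" for \<sigma>
  proof -
    let ?U = "SIGMA i:agents n. set (L i)"
    have "permuted \<sigma> \<phi> n Ob L = ?U \<inter> permuted \<sigma> \<phi> n Ob L"
      using is_matching_permuted[OF inst, of \<sigma>] that by (auto simp: is_matching_def)
    then have "card (permuted \<sigma> \<phi> n Ob L) = card (?U \<inter> permuted \<sigma> \<phi> n Ob L)" by simp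
    also have "\<dots> = (\<Sum>z\<in>?U. if z \<in> permuted \<sigma> \<phi> n Ob L then 1 else 0)"
      by (subst sum.inter_restrict[symmetric]) (auto simp: agents_def)
    also have "\<dots> = (\<Sum>i\<in>agents n. \<Sum>x\<in>set (L i). if (i, x) \<in> permuted \<sigma> \<phi> n Ob L then 1 else 0)"
      by (subst sum.Sigma) (auto simp: agents_def intro!: sum.cong)
    finally show ?thesis .
  qed
  have "(\<Sum>\<sigma>\<in>?P. card (permuted \<sigma> \<phi> n Ob L)) =
      (\<Sum>\<sigma>\<in>?P. \<Sum>i\<in>agents n. \<Sum>x\<in>set (L i). if (i, x) \<in> permuted \<sigma> \<phi> n Ob L then 1 else 0)"
    using card by (intro sum.cong) auto
  also have "\<dots> = (\<Sum>i\<in>agents n. \<Sum>x\<in>set (L i). \<Sum>\<sigma>\<in>?P. if (i, x) \<in> permuted \<sigma> \<phi> n Ob L then 1 else 0)"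
    by (subst sum.swap, rule sum.cong, simp, rule sum.swap)
  also have "\<dots> = (\<Sum>i\<in>agents n. \<Sum>x\<in>set (L i). card (receive n Ob L i x))"
    using fin by (simp add: sum.If_cases receive_def Collect_conj_eq)
  finally have eq: "(\<Sum>\<sigma>\<in>?P. card (permuted \<sigma> \<phi> n Ob L)) =
    (\<Sum>i\<in>agents n. \<Sum>x\<in>set (L i). card (receive n Ob L i x))" .
  have "expected_size (Rand \<phi> n Ob L) = (\<Sum>\<sigma>\<in>?P. real (card (permuted \<sigma> \<phi> n Ob L))) / fact n"
    using integral_pmf_of_set[OF ne fin, of "\<lambda>\<sigma>. real (card (permuted \<sigma> \<phi> n Ob L))"]
    by (simp add: expected_size_def Rand_def cP)
  then show ?thesis unfolding eq[symmetric] by simp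
qed

text \<open>An agent is matched with probability at most 1; this bound serves the agents beyond the
  cutoff \<open>m\<close> below.\<close>

lemma sum_card_receive_objects_le:
  assumes inst: "ha_instance n Ob L"
  shows "(\<Sum>x\<in>set (L i). card (receive n Ob L i x)) \<le> fact n"
proof -
  have "receive n Ob L i x \<inter> receive n Ob L i y = {}" if "x \<noteq> y" for x y
    using that is_matching_permuted[OF inst] unfolding receive_def is_matching_def by blast
  then have "(\<Sum>x\<in>set (L i). card (receive n Ob L i x)) = card (\<Union>x\<in>set (L i). receive n Ob L i x)"
    by (subst card_UN_disjoint) (auto simp: finite_receive)
  also have "\<dots> \<le> card {\<sigma>. \<sigma> permutes agents n}"
    by (rule card_mono) (auto simp: receive_def agents_def finite_permutations)
  also have "\<dots> = fact n"
    by (rule card_permutations) (simp_all add: agents_def)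
  finally show ?thesis .
qed

section \<open>The triangular instance\<close>

text \<open>Agents up to \<open>m\<close> get the harmonic bound, the later ones the trivial bound
  1. The cutoff stays free so that it can be optimised at the end.\<close>

lemma expected_size_triangular_le:
  fixes ob :: "nat \<Rightarrow> 'o"
  assumes ob: "inj ob" and L: "L = (\<lambda>i. if i \<in> agents n then map ob [1..<Suc i] else [])"
    and "m \<le> n"
  shows "ha_instance n (ob ` agents n) L"
    and "expected_size (Rand \<phi> n (ob ` agents n) L)
      \<le> real (n - m) + (\<Sum>i=1..m. \<Sum>j=1..i. 1 / (real n + 1 - real j))"
proof -
  let ?Ob = "ob ` agents n"
  show inst: "ha_instance n ?Ob L"
    by (auto simp: ha_instance_def L pref_list_def agents_def distinct_map inj_eq[OF ob]
        intro: inj_on_subset[OF ob])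
  let ?q = "\<lambda>i x. card (receive n ?Ob L i x) / fact n"
  have setL: "set (L i) = ob ` {1..i}" if "i \<in> agents n" for i
    using that by (auto simp: L)
  have q: "?q i (ob j) \<le> 1 / (real n + 1 - real j)" if "j \<in> {1..i}" "i \<le> n" for i j
  proof -
    have j: "1 \<le> j" "j \<le> n" using that by auto
    let ?p = "map ob [1..<Suc j]"
    have "card {j..n} * card (receive n ?Ob L i (ob j)) \<le> fact n"
    \<comment> \<open>Exactly the agents in \<open>{j..n}\<close> accept \<open>ob j\<close>, and
      their lists all start with \<open>?p\<close>, which ends in \<open>ob j\<close>.\<close>
    proof (rule card_receive_le[OF inst])
      show "{j..n} \<subseteq> agents n" using j by (auto simp: agents_def)
      show "?p = map ob [1..<j] @ [ob j]" using j by simp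
      show "pref_list ?Ob ?p"
        using j by (auto simp: pref_list_def agents_def distinct_map inj_eq[OF ob]
            intro: inj_on_subset[OF ob])
      show "\<exists>ys. L i = ?p @ ys" if "i \<in> {j..n}" for i
      proof
        have "[1..<Suc i] = [1..<Suc j] @ [Suc j..<Suc i]"
          using that j upt_add_eq_append[of 1 "Suc j" "i - j"] by simp
        then show "L i = ?p @ map ob [Suc j..<Suc i]"
          using that j by (simp add: L agents_def del: upt_Suc)
      qed
      show "ob j \<notin> set (L i)" if "i \<notin> {j..n}" for i
        using that by (auto simp: L agents_def inj_eq[OF ob])
      show "i \<in> {j..n}" using that by simp
    qed
    then have "real (card {j..n} * card (receive n ?Ob L i (ob j))) \<le> fact n"
      by (metis of_nat_fact of_nat_le_iff)
    moreover have "real (card {j..n}) = real n + 1 - real j" using j by simp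
    ultimately show ?thesis using j by (simp add: field_simps)
  qed
  let ?row = "\<lambda>i. \<Sum>x\<in>set (L i). ?q i x"
  have row_le_1: "?row i \<le> 1" for i
  proof -
    have "real (\<Sum>x\<in>set (L i). card (receive n ?Ob L i x)) \<le> fact n"
      using sum_card_receive_objects_le[OF inst, of i] by (metis of_nat_fact of_nat_le_iff)
    then show ?thesis by (simp add: sum_divide_distrib[symmetric])
  qed
  have row: "?row i \<le> (\<Sum>j=1..i. 1 / (real n + 1 - real j))" if "i \<in> agents n" for i
  proof -
    have "?row i = (\<Sum>j=1..i. ?q i (ob j))"
      unfolding setL[OF that] using ob by (subst sum.reindex) (auto intro: inj_on_subset)
    also have "\<dots> \<le> (\<Sum>j=1..i. 1 / (real n + 1 - real j))"
      using q that by (intro sum_mono) (auto simp: agents_def)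
    finally show ?thesis .
  qed
  have "expected_size (Rand \<phi> n ?Ob L) = (\<Sum>i\<in>{1..m} \<union> {m+1..n}. ?row i)"
    using expected_size_Rand[OF inst] \<open>m \<le> n\<close>
    by (simp add: sum_divide_distrib agents_def ivl_disj_un_two_touch)
      (intro sum.cong; auto)
  also have "\<dots> = (\<Sum>i=1..m. ?row i) + (\<Sum>i=m+1..n. ?row i)"
    by (rule sum.union_disjoint) auto
  also have "\<dots> \<le> (\<Sum>i=1..m. \<Sum>j=1..i. 1 / (real n + 1 - real j)) + (\<Sum>i=m+1..n. 1)"
    using row \<open>m \<le> n\<close> by (intro add_mono sum_mono row_le_1) (auto simp: agents_def)
  finally show "expected_size (Rand \<phi> n ?Ob L)
      \<le> real (n - m) + (\<Sum>i=1..m. \<Sum>j=1..i. 1 / (real n + 1 - real j))"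
    by simp
qed

end

section \<open>Harmonic sums and logarithms\<close>

text \<open>The reciprocal for \<open>j\<close> occurs in the \<open>m + 1 - j\<close> rows
  \<open>i = j, ..., m\<close>, and \<open>m + 1 - j = (n + 1 - j) - (n - m)\<close>. The proof
  checks the resulting closed form by induction.\<close>

lemma triangular_sum:
  assumes "m \<le> n"
  shows "(\<Sum>i=1..m. \<Sum>j=1..i. 1 / (real n + 1 - real j)) =
    real m - real (n - m) * (\<Sum>j=1..m. 1 / (real n + 1 - real j))"
  using assms
proof (induction m)
  case (Suc m)
  define d where "d = real n - real m"
  define s where "s = (\<Sum>j=1..m. 1 / (real n + 1 - real j))"
  have d: "d > 0" "real (n - m) = d" "real (n - Suc m) = d - 1" "real n + 1 - real (Suc m) = d"
    using Suc.prems by (auto simp: d_def)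
  have s: "(\<Sum>j=1..Suc m. 1 / (real n + 1 - real j)) = s + 1 / d"
    using d(4) by (simp add: s_def)
  have "(\<Sum>i=1..Suc m. \<Sum>j=1..i. 1 / (real n + 1 - real j)) = (real m - d * s) + (s + 1 / d)"
    using Suc s d(2) by (simp add: s_def)
  also have "\<dots> = real (Suc m) - (d - 1) * (s + 1 / d)"
    using d(1) by (simp add: field_simps)
  finally show ?case
    unfolding s d(3) .
qed simp

text \<open>The quotient telescopes into factors \<open>1 + 1 / d\<close> with
  \<open>d = n + 1 - j\<close>, and \<open>ln (1 + 1 / d) \<le> 1 / d\<close>.\<close>

lemma ln_le_sum_reciprocals:
  assumes "m \<le> n"
  shows "ln ((real n + 1) / (real n + 1 - real m)) \<le> (\<Sum>j=1..m. 1 / (real n + 1 - real j))"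
  using assms
proof (induction m)
  case (Suc m)
  define d where "d = real n - real m"
  have d: "d > 0" using Suc.prems by (simp add: d_def)
  have "1 + 1 / d = (d + 1) / d"
    using d by (simp add: field_simps)
  then have "ln ((real n + 1) / d) = ln ((real n + 1) / (d + 1)) + ln (1 + 1 / d)"
    using d by (simp add: ln_div)
  moreover have "ln (1 + 1 / d) \<le> 1 / d"
    using d by (intro ln_add_one_self_le_self) auto
  ultimately show ?case
    using Suc by (simp add: d_def algebra_simps)
qed simp

section \<open>Choice of the cutoff and the limit\<close>

theorem theorem6p4:
  fixes \<phi> :: "'o :: infinite mechanism"
  assumes "is_mechanism \<phi>"
    and "truthful \<phi>"
    and "non_bossy \<phi>"
    and "pareto_optimal \<phi>"
  shows "\<not> (\<exists>c::real. c < exp 1 / (exp 1 - 1) \<and> approximates c (Rand \<phi>))"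
proof
  assume "\<exists>c::real. c < exp 1 / (exp 1 - 1) \<and> approximates c (Rand \<phi>)"
  then obtain c :: real where c: "c < exp 1 / (exp 1 - 1)" and approx: "approximates c (Rand \<phi>)"
    by blast
  \<comment> \<open>Triangular instances of unbounded size are used, so infinitely many objects must
    be available.\<close>
  obtain ob :: "nat \<Rightarrow> 'o" where ob: "inj ob"
    using infinite_countable_subset[OF infinite_UNIV] by blast
  \<comment> \<open>A floor-free upper bound on the expected size: \<open>k\<close> is replaced by
    \<open>t / exp 1 - 1\<close> as a factor and by \<open>t / exp 1\<close> inside the
    logarithm.\<close>
  define g :: "real \<Rightarrow> real"
    where "g t = t - (t / exp 1 - 1) * ln ((t + 1) / (t / exp 1 + 1))" for t
  have bound: "0 < c \<and> real n \<le> c * g (real n)" if "n > 0" for n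
  proof -
    define L where "L = (\<lambda>i. if i \<in> agents n then map ob [1..<Suc i] else [])"
    let ?E = "expected_size (Rand \<phi> n (ob ` agents n) L)"
    \<comment> \<open>The real function \<open>k * ln (n / k)\<close>, which approximates the loss
      in size, is maximal at \<open>k = n / e\<close>.\<close>
    define k where "k = nat \<lfloor>real n / exp 1\<rfloor>"
    have k: "real n / exp 1 - 1 \<le> real k" "real k \<le> real n / exp 1"
      unfolding k_def by (linarith, simp)
    have "real n / exp 1 \<le> real n"
      using mult_left_mono[of 1 "exp 1" "real n"] by (simp add: divide_le_eq)
    then have kn: "k \<le> n" using k by linarith
    note tri = expected_size_triangular_le[OF assms(2-4) ob L_def, of "n - k"]
    have "(real n / exp 1 - 1) * ln ((real n + 1) / (real n / exp 1 + 1))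
        \<le> real k * ln ((real n + 1) / (real k + 1))"
    \<comment> \<open>The factor \<open>real n / exp 1 - 1\<close> may be negative for small
      \<open>n\<close>; only \<open>real k\<close> and the left logarithm have to be
      nonnegative.\<close>
    proof (intro mult_mono)
      have "0 < real n / exp 1 + 1" by (simp add: add_pos_nonneg add.commute)
      then show "ln ((real n + 1) / (real n / exp 1 + 1)) \<le> ln ((real n + 1) / (real k + 1))"
        using k by (intro ln_mono divide_left_mono) auto
      show "0 \<le> ln ((real n + 1) / (real n / exp 1 + 1))"
        using \<open>real n / exp 1 \<le> real n\<close> \<open>0 < real n / exp 1 + 1\<close> by (intro ln_ge_zero) simp
    qed (use k in auto)
    also have "\<dots> \<le> real k * (\<Sum>j=1..n - k. 1 / (real n + 1 - real j))"
      using ln_le_sum_reciprocals[of "n - k" n] kn by (intro mult_left_mono) (auto simp: of_nat_diff add.commute)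
    finally have E: "?E \<le> g (real n)"
      using tri(2) triangular_sum[of "n - k" n] kn by (simp add: g_def of_nat_diff)
    \<comment> \<open>Each agent takes the last object of his list.\<close>
    have "is_matching n L ((\<lambda>i. (i, ob i)) ` agents n)"
      by (auto simp: is_matching_def L_def agents_def inj_eq[OF ob])
    then have "card ((\<lambda>i. (i, ob i)) ` agents n) \<le> max_matching_size n L"
      unfolding max_matching_size_def by (intro Max_ge finite_imageI finite_matchings) auto
    moreover have "card ((\<lambda>i. (i, ob i)) ` agents n) = n"
      by (subst card_image) (auto simp: inj_on_def agents_def)
    ultimately have le: "real n \<le> c * ?E"
      using approx tri(1) unfolding approximates_def by fastforce
    have "?E \<ge> 0"
      by (simp add: expected_size_def)
    \<comment> \<open>The sign of \<open>c\<close> is needed to replace \<open>?E\<close> by its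
      upper bound \<open>g (real n)\<close>.\<close>
    then have "0 < c"
      using le that by (metis linorder_not_le mult_nonneg_nonneg mult_nonpos_nonneg of_nat_0_less_iff
          order.strict_trans1)
    then show ?thesis
      using le E by (meson less_imp_le mult_left_mono order_trans)
  qed
  \<comment> \<open>The argument of the logarithm tends to \<open>exp 1\<close>, so the logarithm
    tends to 1 and its coefficient divided by \<open>n\<close> to \<open>1 / exp 1\<close>.\<close>
  have "(\<lambda>n. c * (g (real n) / real n)) \<longlonglongrightarrow> c * (1 - inverse (exp 1))"
    unfolding g_def by (intro tendsto_mult tendsto_const) real_asymp
  moreover have "eventually (\<lambda>n. 1 \<le> c * (g (real n) / real n)) sequentially"
    using bound by (intro eventually_mono[OF eventually_gt_at_top[of 0]]) (auto simp: field_simps)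
  ultimately have "1 \<le> c * (1 - inverse (exp 1))"
    by (intro tendsto_lowerbound) auto
  then have "exp 1 \<le> c * (exp 1 - 1)"
    by (simp add: field_simps)
  moreover have "exp 1 > (1::real)" by simp
  ultimately show False
    using c by (simp add: field_simps)
qed

end
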